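(* Let $h,m\in\mathbb{N}\setminus\{0\}$ and $\lambda\in[0,1]$. Let $v_0\in\mathbb{R}^{|\mathcal{S}|}$ be arbitrary, and let $\{\epsilon_k\}$ and $\{\delta_k\}$ be noise sequences with $\epsilon_k\in\mathbb{R}^{|\mathcal S|}$, $\delta_k\in\mathbb{R}^{|\mathcal S|}_+$, $\|\epsilon_k\|_\infty\le\epsilon$ and $\|\delta_k\|_\infty\le\delta$ for all $k$. Let $(v_k)_{k\ge 0}$ and $(\pi_k)_{k\ge1}$ be generated either by $hm$-PI, i.e. for all $k\ge0$ $$\pi_{k+1}\in\mathcal{G}_h^{\delta_{k+1}}(v_k),\qquad v_{k+1}=(T^{\pi_{k+1}})^mT^{h-1}v_k+\epsilon_k,$$ or by $h\lambda$-PI, i.e. for all $k\ge0$ $$\pi_{k+1}\in\mathcal{G}_h^{\delta_{k+1}}(v_k),\qquad v_{k+1}=T^{\pi_{k+1}}_\lambda T^{h-1}v_k+\epsilon_k.$$ Let $$\Delta_0=\max\left\{0,\ \frac{\max_s\left(T^{h-1}v_0-T^{\pi_1}T^{h-1}v_0\right)(s)}{\gamma^{h-1}(1-\gamma)}\right\}.$$ Then, in either case, for all $k\ge 0$, $$\|v^*-v^{\pi_{k+1}}\|_\infty\le\gamma^{kh}\|v^*-(v_0-\Delta_0)\|_\infty+\frac{(2\gamma^h\epsilon+\delta)(1-\gamma^{kh})}{(1-\gamma)(1-\gamma^h)},$$ and hence $$\limsup_{k\to\infty}\|v^*-v^{\pi_k}\|_\infty\le\frac{2\gamma^h\epsilo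n+\delta}{(1-\gamma)(1-\gamma^h)}.$$
   Context: Setting: an infinite-horizon discounted Markov decision process $(\mathcal{S},\mathcal{A},P,R,\gamma)$ with finite state space $\mathcal{S}$, finite action space $\mathcal{A}$, transition kernel $P(s'\mid s,a)$, reward function $r(s,a)\in[R_{\min},R_{\max}]$ and discount factor $\gamma\in(0,1)$. A policy is a stationary map $\pi:\mathcal{S}\to\mathcal{P}(\mathcal{A})$ into probability distributions on $\mathcal{A}$. Let $[P^\pi]_{s,s'}=P(s'\mid s,\pi(s))$ and $[r^\pi]_s=r(s,\pi(s))$ (averaged over the action distribution $\pi(s)$). The value of $\pi$ is $v^\pi=\sum_{t\ge0}\gamma^t(P^\pi)^tr^\pi=(I-\gamma P^\pi)^{-1}r^\pi$, and the optimal value is $v^*=\max_\pi v^\pi$ (component-wise). Value functions are vectors $v\in\mathbb{R}^{|\mathcal S|}$; inequalities between vectors are component-wise; $v-c$ for a scalar $c$ means subtracting $c$ from every component. Bellman operators: $T^\pi v=r^\pi+\gamma P^\pi v$ and $Tv=\max_\pi T^\pi v$ (component-wise); $T^{j}$ is the $j$-fold iterate, with $T^0$ the identity. $\lambda$-return operator: for $\lambda\in[0,1]$, $T^\pi_\lambda v=v+(I-\gamma\lambda P^\pi)^{-1}(T^\pi v-v)$, which for $\lambda<1$ equals $(1-\lambda)\sum_{j=0}^\infty\lambda^j(T^\pi)^{j+1}v$. Approximate $h$-greedy set: for $\hat\delta\in\mathbb{R}^{|\mathcal S|}_+$, $\mathcal{G}_h^{\hat\delta}(v)$ is the set of policies $\pi$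 with $T^\pi T^{h-1}v\ge T^hv-\hat\delta$. *)

theory Defs
  imports "HOL-Probability.Probability"
begin

text \<open>
  A finite discounted MDP is given by a kernel \<open>P\<close>, a reward \<open>r\<close> and a discount factor \<open>\<gamma>\<close>, over
  finite (hence nonempty) types of states and actions. Value functions are vectors in \<open>real ^ 's\<close>,
  whose order \<open>\<le>\<close> is component-wise; the sup-norm is \<open>infnorm\<close> (\<open>norm\<close> is the Euclidean one).
\<close>

type_synonym ('s, 'a) kernel = "'s \<Rightarrow> 'a \<Rightarrow> 's pmf"
type_synonym ('s, 'a) reward = "'s \<Rightarrow> 'a \<Rightarrow> real"
type_synonym ('s, 'a) policy = "'s \<Rightarrow> 'a pmf"

definition P_pol ::
  "('s::finite, 'a::finite) kernel \<Rightarrow> ('s, 'a) policy \<Rightarrow> real ^ 's ^ 's" where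
  "P_pol P \<pi> = (\<chi> s s'. \<Sum>a\<in>UNIV. pmf (\<pi> s) a * pmf (P s a) s')"

definition r_pol ::
  "('s::finite, 'a::finite) reward \<Rightarrow> ('s, 'a) policy \<Rightarrow> real ^ 's" where
  "r_pol r \<pi> = (\<chi> s. \<Sum>a\<in>UNIV. pmf (\<pi> s) a * r s a)"

text \<open>
  The power \<open>^\<close> on \<open>real ^ 's ^ 's\<close> is component-wise, so powers of the transition matrix are
  written as iterates of matrix-vector multiplication.
\<close>

definition value_pol ::
  "('s::finite, 'a::finite) kernel \<Rightarrow> ('s, 'a) reward \<Rightarrow> real \<Rightarrow> ('s, 'a) policy \<Rightarrow> real ^ 's" where
  "value_pol P r \<gamma> \<pi> = (\<Sum>t. \<gamma> ^ t *\<^sub>R ((\<lambda>x. P_pol P \<pi> *v x) ^^ t) (r_pol r \<pi>))"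

text \<open>
  There are infinitely many (randomised) policies, so the component-wise maxima over policies are
  written as suprema; for \<open>0 < \<gamma> < 1\<close> they are attained.
\<close>

definition value_opt ::
  "('s::finite, 'a::finite) kernel \<Rightarrow> ('s, 'a) reward \<Rightarrow> real \<Rightarrow> real ^ 's" where
  "value_opt P r \<gamma> = (\<chi> s. SUP \<pi>. value_pol P r \<gamma> \<pi> $ s)"

definition bellman_pol ::
  "('s::finite, 'a::finite) kernel \<Rightarrow> ('s, 'a) reward \<Rightarrow> real \<Rightarrow> ('s, 'a) policy
    \<Rightarrow> real ^ 's \<Rightarrow> real ^ 's" where
  "bellman_pol P r \<gamma> \<pi> v = r_pol r \<pi> + \<gamma> *\<^sub>R (P_pol P \<pi> *v v)"

definition bellman_opt ::
  "('s::finite, 'a::finite) kernel \<Rightarrow> ('s, 'a) reward \<Rightarrow> real \<Rightarrow> real ^ 's \<Rightarrow> real ^ 's" where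
  "bellman_opt P r \<gamma> v = (\<chi> s. SUP \<pi>. bellman_pol P r \<gamma> \<pi> v $ s)"

definition bellman_lambda ::
  "('s::finite, 'a::finite) kernel \<Rightarrow> ('s, 'a) reward \<Rightarrow> real \<Rightarrow> real \<Rightarrow> ('s, 'a) policy
    \<Rightarrow> real ^ 's \<Rightarrow> real ^ 's" where
  "bellman_lambda P r \<gamma> l \<pi> v =
     v + matrix_inv (mat 1 - (\<gamma> * l) *\<^sub>R P_pol P \<pi>) *v (bellman_pol P r \<gamma> \<pi> v - v)"

definition approx_greedy ::
  "('s::finite, 'a::finite) kernel \<Rightarrow> ('s, 'a) reward \<Rightarrow> real \<Rightarrow> nat \<Rightarrow> real ^ 's
    \<Rightarrow> real ^ 's \<Rightarrow> ('s, 'a) policy set" where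
  "approx_greedy P r \<gamma> h d v =
     {\<pi>. bellman_pol P r \<gamma> \<pi> ((bellman_opt P r \<gamma> ^^ (h - 1)) v) \<ge> (bellman_opt P r \<gamma> ^^ h) v - d}"

definition hm_PI ::
  "('s::finite, 'a::finite) kernel \<Rightarrow> ('s, 'a) reward \<Rightarrow> real \<Rightarrow> nat \<Rightarrow> nat
    \<Rightarrow> (nat \<Rightarrow> real ^ 's) \<Rightarrow> (nat \<Rightarrow> real ^ 's)
    \<Rightarrow> (nat \<Rightarrow> real ^ 's) \<Rightarrow> (nat \<Rightarrow> ('s, 'a) policy) \<Rightarrow> bool" where
  "hm_PI P r \<gamma> h m err del v \<pi> \<longleftrightarrow>
     (\<forall>k. \<pi> (Suc k) \<in> approx_greedy P r \<gamma> h (del (Suc k)) (v k) \<and>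
          v (Suc k) = (bellman_pol P r \<gamma> (\<pi> (Suc k)) ^^ m)
                        ((bellman_opt P r \<gamma> ^^ (h - 1)) (v k)) + err k)"

definition hlambda_PI ::
  "('s::finite, 'a::finite) kernel \<Rightarrow> ('s, 'a) reward \<Rightarrow> real \<Rightarrow> nat \<Rightarrow> real
    \<Rightarrow> (nat \<Rightarrow> real ^ 's) \<Rightarrow> (nat \<Rightarrow> real ^ 's)
    \<Rightarrow> (nat \<Rightarrow> real ^ 's) \<Rightarrow> (nat \<Rightarrow> ('s, 'a) policy) \<Rightarrow> bool" where
  "hlambda_PI P r \<gamma> h l err del v \<pi> \<longleftrightarrow>
     (\<forall>k. \<pi> (Suc k) \<in> approx_greedy P r \<gamma> h (del (Suc k)) (v k) \<and>
          v (Suc k) = bellman_lambda P r \<gamma> l (\<pi> (Suc k))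
                        ((bellman_opt P r \<gamma> ^^ (h - 1)) (v k)) + err k)"

end

theory Submission
  imports Defs
begin

text \<open>
  Let \<open>L\<close> be the evaluation operator \<open>(T\<^sup>\<pi>)\<^sup>m\<close> or \<open>T\<^sup>\<pi>\<^sub>\<lambda>\<close>, and subtract from \<open>v\<^sub>k\<close> a
  constant \<open>\<Delta>\<^sub>k\<close> so large that \<open>x\<^sub>k = T\<^sup>h\<^sup>-\<^sup>1 (v\<^sub>k - \<Delta>\<^sub>k)\<close> satisfies \<open>x\<^sub>k \<le> T\<^sup>\<pi> x\<^sub>k\<close>. Both evaluation operators turn
  such a subsolution into a subsolution above \<open>T\<^sup>\<pi> x\<^sub>k\<close>, and both map \<open>u - c\<close> to \<open>L u - \<beta> c\<close> for a
  constant \<open>\<beta>\<close>; hence \<open>\<Delta>\<^sub>k\<close> can be chosen by a linear recursion. With \<open>y\<^sub>k = T\<^sup>\<pi> x\<^sub>k\<close> one gets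
  \<open>y\<^sub>k \<le> v\<^sup>\<pi>\<close> and \<open>y\<^sub>k\<^sub>+\<^sub>1 \<ge> T\<^sup>h y\<^sub>k - (2\<gamma>\<^sup>h\<epsilon> + \<delta>)/(1 - \<gamma>)\<close>. The bound follows since \<open>T\<^sup>h\<close> contracts
  by \<open>\<gamma>\<^sup>h\<close> and \<open>v\<^sup>* \<le> T v\<^sup>*\<close>. Tracking \<open>y\<^sub>k\<close> rather than \<open>v\<^sub>k - \<Delta>\<^sub>k\<close> is what keeps the first greedy
  error \<open>\<delta>\<^sub>1\<close> out of the bound.
\<close>

section \<open>Stochastic transition matrices and the sup-norm\<close>

lemma P_pol_nonneg: "0 \<le> P_pol P \<pi> $ s $ s'"
  by (simp add: P_pol_def sum_nonneg)

lemma P_pol_row_sum: "(\<Sum>s'\<in>UNIV. P_pol P \<pi> $ s $ s') = 1"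
proof -
  have "(\<Sum>s'\<in>UNIV. P_pol P \<pi> $ s $ s')
      = (\<Sum>a\<in>UNIV. pmf (\<pi> s) a * (\<Sum>s'\<in>UNIV. pmf (P s a) s'))"
    unfolding P_pol_def by (simp add: sum_distrib_left) (rule sum.swap)
  also have "\<dots> = 1"
    by (simp add: sum_pmf_eq_1)
  finally show ?thesis .
qed

lemma P_pol_mono: "x \<le> y \<Longrightarrow> P_pol P \<pi> *v x \<le> P_pol P \<pi> *v y"
  by (auto simp: less_eq_vec_def matrix_vector_mult_def P_pol_nonneg
      intro!: sum_mono mult_left_mono)

lemma P_pol_vec: "P_pol P \<pi> *v vec c = vec c"
  by (simp add: vec_eq_iff matrix_vector_mult_def P_pol_row_sum flip: sum_distrib_right)

lemma matrix_vector_mult_uminus: "A *v (- x) = - (A *v x)" for A :: "real ^ 'n ^ 'm"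
  using matrix_vector_mult_diff_distrib[of A 0 x] by simp

lemma vec_le_of_abs_le:
  fixes x :: "real ^ 'n"
  assumes "\<And>i. \<bar>x $ i\<bar> \<le> B"
  shows "vec (- B) \<le> x" "x \<le> vec B"
  using assms by (auto simp: less_eq_vec_def abs_le_iff) (metis minus_le_iff)

lemma infnorm_vec_le_iff:
  fixes x :: "real ^ 'n"
  shows "infnorm x \<le> B \<longleftrightarrow> (\<forall>i. \<bar>x $ i\<bar> \<le> B)"
proof
  assume "infnorm x \<le> B"
  then show "\<forall>i. \<bar>x $ i\<bar> \<le> B"
    using component_le_infnorm_cart order_trans by blast
next
  assume "\<forall>i. \<bar>x $ i\<bar> \<le> B"
  then show "infnorm x \<le> B"
    unfolding infnorm_cart by (intro cSup_least) auto
qed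

lemma P_pol_abs_le:
  assumes "\<And>i. \<bar>x $ i\<bar> \<le> B"
  shows "\<bar>(P_pol P \<pi> *v x) $ s\<bar> \<le> B"
  using P_pol_mono[OF vec_le_of_abs_le(1)[of x, OF assms], of P \<pi>]
    P_pol_mono[OF vec_le_of_abs_le(2)[of x, OF assms], of P \<pi>]
  by (auto simp: P_pol_vec less_eq_vec_def abs_le_iff minus_le_iff)

text \<open>Maximum principle: at a state where \<open>x\<close> attains its maximum
  \<open>M\<close>, stochasticity gives \<open>M \<le> g * M\<close>, so \<open>M \<le> 0\<close>.
  All comparisons with fixed points below rest on it.\<close>

lemma subinvariant_nonpos:
  assumes g: "0 \<le> g" "g < 1" and x: "x \<le> g *\<^sub>R (P_pol P \<pi> *v x)"
  shows "x \<le> 0"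
proof -
  define M where "M = (MAX s. x $ s)"
  have le: "x $ s \<le> M" for s
    unfolding M_def by (intro Max_ge) auto
  obtain s where s: "x $ s = M"
    using Max_in[of "range (\<lambda>s. x $ s)"] unfolding M_def by fastforce
  have "P_pol P \<pi> *v x \<le> vec M"
    using P_pol_mono[of x "vec M" P \<pi>] le by (simp add: P_pol_vec less_eq_vec_def)
  then have "(P_pol P \<pi> *v x) $ s \<le> M"
    by (simp add: less_eq_vec_def)
  then have "g * (P_pol P \<pi> *v x) $ s \<le> g * M"
    using g by (simp add: mult_left_mono)
  moreover have "M \<le> g * (P_pol P \<pi> *v x) $ s"
    using x s by (auto simp: less_eq_vec_def)
  ultimately have "M * (1 - g) \<le> 0"
    by (simp add: algebra_simps)
  then have "M \<le> 0"
    using g by (simp add: mult_le_0_iff)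
  then show ?thesis
    using le by (auto simp: less_eq_vec_def intro: order_trans)
qed

text \<open>In finite dimension a trivial kernel suffices. A kernel vector satisfies
  \<open>x = g *\<^sub>R (P_pol P \<pi> *v x)\<close>, so the maximum principle applies to both
  \<open>x\<close> and \<open>- x\<close>.\<close>

lemma discount_invertible:
  assumes g: "0 \<le> g" "g < 1"
  shows "invertible (mat 1 - g *\<^sub>R P_pol P \<pi>)"
proof -
  have mv: "(mat 1 - g *\<^sub>R P_pol P \<pi>) *v x = x - g *\<^sub>R (P_pol P \<pi> *v x)" for x
    by (simp add: matrix_vector_mult_diff_rdistrib scaleR_matrix_vector_assoc)
  have "x = 0" if "(mat 1 - g *\<^sub>R P_pol P \<pi>) *v x = 0" for x
  proof (rule antisym)
    have eq: "x = g *\<^sub>R (P_pol P \<pi> *v x)"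
      using that by (simp add: mv)
    then have "x \<le> g *\<^sub>R (P_pol P \<pi> *v x)"
      by (rule eq_refl)
    then show "x \<le> 0"
      by (rule subinvariant_nonpos[OF g])
    have "- x = g *\<^sub>R (P_pol P \<pi> *v (- x))"
      using eq by (metis mult_minus_right scaleR_minus_right matrix_vector_mult_uminus)
    then have "- x \<le> g *\<^sub>R (P_pol P \<pi> *v (- x))"
      by (rule eq_refl)
    then have "- x \<le> 0"
      by (rule subinvariant_nonpos[OF g])
    then show "0 \<le> x"
      by (simp add: less_eq_vec_def)
  qed
  then show ?thesis
    using matrix_left_invertible_ker invertible_left_inverse by blast
qed

lemma discount_inv_inverse:
  fixes P :: "('s::finite, 'a::finite) kernel" and \<pi>
  assumes g: "0 \<le> g" "g < 1"
  defines "A \<equiv> mat 1 - g *\<^sub>R P_pol P \<pi>"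
  shows "A ** matrix_inv A = mat 1" "matrix_inv A ** A = mat 1"
  using someI_ex[OF discount_invertible[OF g, of P \<pi>, unfolded invertible_def]]
  unfolding A_def matrix_inv_def by auto

text \<open>Allows the inverse to be evaluated by guessing a solution of the fixed-point
  equation.\<close>

lemma discount_inv_unique:
  assumes g: "0 \<le> g" "g < 1" and z: "z = b + g *\<^sub>R (P_pol P \<pi> *v z)"
  shows "matrix_inv (mat 1 - g *\<^sub>R P_pol P \<pi>) *v b = z"
proof -
  let ?A = "mat 1 - g *\<^sub>R P_pol P \<pi>"
  have "?A *v z = b"
    using z by (simp add: matrix_vector_mult_diff_rdistrib scaleR_matrix_vector_assoc algebra_simps)
  moreover have "matrix_inv ?A ** ?A = mat 1"
    by (rule discount_inv_inverse[OF g])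
  ultimately show ?thesis
    by (metis matrix_vector_mul_assoc matrix_vector_mul_lid)
qed

lemma discount_inv_eq:
  fixes P :: "('s::finite, 'a::finite) kernel" and \<pi> and b
  assumes g: "0 \<le> g" "g < 1"
  defines "z \<equiv> matrix_inv (mat 1 - g *\<^sub>R P_pol P \<pi>) *v b"
  shows "z = b + g *\<^sub>R (P_pol P \<pi> *v z)"
proof -
  let ?A = "mat 1 - g *\<^sub>R P_pol P \<pi>"
  have "?A ** matrix_inv ?A = mat 1"
    by (rule discount_inv_inverse[OF g])
  then have "?A *v z = b"
    unfolding z_def by (simp add: matrix_vector_mul_assoc)
  then show ?thesis
    by (simp add: matrix_vector_mult_diff_rdistrib scaleR_matrix_vector_assoc algebra_simps)
qed

section \<open>Bellman operators: monotonicity and constant shifts\<close>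

locale discounted_mdp =
  fixes P :: "('s::finite, 'a::finite) kernel"
    and r :: "('s, 'a) reward"
    and \<gamma> :: real
  assumes gamma_pos: "0 < \<gamma>" and gamma_less_1: "\<gamma> < 1"
begin

abbreviation "Tp \<equiv> bellman_pol P r \<gamma>"
abbreviation "T \<equiv> bellman_opt P r \<gamma>"
abbreviation "V \<equiv> value_pol P r \<gamma>"
abbreviation "Vopt \<equiv> value_opt P r \<gamma>"

lemma Tp_mono: "x \<le> y \<Longrightarrow> Tp \<pi> x \<le> Tp \<pi> y"
  using P_pol_mono[of x y P \<pi>] gamma_pos
  by (auto simp: bellman_pol_def less_eq_vec_def mult_left_mono)

lemma Tp_add: "Tp \<pi> (x + y) = Tp \<pi> x + \<gamma> *\<^sub>R (P_pol P \<pi> *v y)"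
  by (simp add: bellman_pol_def algebra_simps matrix_vector_right_distrib)

lemma Tp_shift: "Tp \<pi> (x - vec c) = Tp \<pi> x - vec (\<gamma> * c)"
proof -
  have "x - vec c = x + vec (- c)"
    by (simp add: vec_eq_iff)
  then show ?thesis
    by (simp only: Tp_add P_pol_vec) (simp add: vec_eq_iff)
qed

text \<open>The bound is uniform over the infinitely many policies, so that the suprema defining
  \<open>T\<close> and \<open>Vopt\<close> are taken over bounded sets.\<close>

lemma r_pol_bound: "\<exists>B. \<forall>\<pi> s. \<bar>r_pol r \<pi> $ s\<bar> \<le> B"
proof (intro exI allI)
  fix \<pi> :: "('s, 'a) policy" and s
  let ?B = "\<Sum>s\<in>UNIV. \<Sum>a\<in>UNIV. \<bar>r s a\<bar>"
  have "\<bar>r_pol r \<pi> $ s\<bar> \<le> (\<Sum>a\<in>UNIV. \<bar>pmf (\<pi> s) a * r s a\<bar>)"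
    unfolding r_pol_def by (simp add: sum_abs)
  also have "\<dots> \<le> (\<Sum>a\<in>UNIV. \<bar>r s a\<bar>)"
    by (intro sum_mono) (simp add: abs_mult pmf_le_1 mult_left_le_one_le)
  also have "\<dots> \<le> ?B"
    by (rule member_le_sum) (auto intro: sum_nonneg)
  finally show "\<bar>r_pol r \<pi> $ s\<bar> \<le> ?B" .
qed

lemma Tp_bdd_above: "bdd_above (range (\<lambda>\<pi>. Tp \<pi> x $ s))"
proof -
  obtain B where B: "\<And>\<pi> s. \<bar>r_pol r \<pi> $ s\<bar> \<le> B"
    using r_pol_bound by blast
  have "Tp \<pi> x $ s \<le> B + \<gamma> * norm x" for \<pi>
  proof -
    have "(P_pol P \<pi> *v x) $ s \<le> norm x"
      using P_pol_abs_le[of x "norm x" P \<pi> s] component_le_norm_cart[of x] by force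
    then show ?thesis
      using B[of \<pi> s] gamma_pos by (auto simp: bellman_pol_def intro!: add_mono mult_left_mono)
  qed
  then show ?thesis
    by (intro bdd_aboveI) auto
qed

lemma Tp_le_T: "Tp \<pi> x \<le> T x"
  by (auto simp: bellman_opt_def less_eq_vec_def intro!: cSUP_upper Tp_bdd_above)

lemma T_le: "(\<And>\<pi>. Tp \<pi> x \<le> y) \<Longrightarrow> T x \<le> y"
  by (auto simp: bellman_opt_def less_eq_vec_def intro!: cSUP_least)

lemma T_mono: "x \<le> y \<Longrightarrow> T x \<le> T y"
  by (rule T_le) (blast intro: order_trans Tp_mono Tp_le_T)

lemma T_shift: "T (x - vec c) = T x - vec (\<gamma> * c)"
proof -
  have *: "T (x - vec c) \<le> T x - vec (\<gamma> * c)" for x c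
    by (rule T_le) (simp add: Tp_shift Tp_le_T)
  have eq: "x - vec c - vec (- c) = x"
    by (simp add: vec_eq_iff)
  \<comment> \<open>The reverse inequality is the first one, applied to \<open>x - vec c\<close>
    with the shift \<open>- c\<close>.\<close>
  have "T x \<le> T (x - vec c) - vec (\<gamma> * - c)"
    using *[of "x - vec c" "- c"] unfolding eq .
  then show ?thesis
    by (intro antisym *) (simp add: less_eq_vec_def algebra_simps)
qed

lemma T_pow_mono: "x \<le> y \<Longrightarrow> (T ^^ n) x \<le> (T ^^ n) y"
  by (induction n) (auto intro: T_mono)

lemma T_pow_shift: "(T ^^ n) (x - vec c) = (T ^^ n) x - vec (\<gamma> ^ n * c)"
  by (induction n) (simp_all add: T_shift mult.assoc)

section \<open>Policy values and the optimal value\<close>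

lemma value_pol_fixpoint: "Tp \<pi> (V \<pi>) = V \<pi>"
proof -
  define f where "f t = \<gamma> ^ t *\<^sub>R ((\<lambda>x. P_pol P \<pi> *v x) ^^ t) (r_pol r \<pi>)" for t
  obtain B where B: "\<And>\<pi> s. \<bar>r_pol r \<pi> $ s\<bar> \<le> B"
    using r_pol_bound by blast
  have iter: "\<bar>((\<lambda>x. P_pol P \<pi> *v x) ^^ t) (r_pol r \<pi>) $ s\<bar> \<le> B" for t s
    by (induction t arbitrary: s) (auto simp: B intro: P_pol_abs_le)
  \<comment> \<open>The components are bounded by \<open>B\<close>; passing to the Euclidean norm
    through the l1 norm costs the factor \<open>CARD('s)\<close>.\<close>
  have "norm (f t) \<le> (of_nat CARD('s) * B) * \<gamma> ^ t" for t
  proof -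
    have "norm (((\<lambda>x. P_pol P \<pi> *v x) ^^ t) (r_pol r \<pi>)) \<le> of_nat CARD('s) * B"
      by (rule order_trans[OF norm_le_l1_cart sum_bounded_above]) (rule iter)
    then show ?thesis
      using gamma_pos by (simp add: f_def mult.commute mult_left_mono)
  qed
  moreover have "summable (\<lambda>t. (of_nat CARD('s) * B) * \<gamma> ^ t)"
    using gamma_pos gamma_less_1 by (intro summable_mult summable_geometric) auto
  ultimately have sf: "summable f"
    by (intro summable_comparison_test'[of _ 0 f])
  have lin: "bounded_linear (\<lambda>x. \<gamma> *\<^sub>R (P_pol P \<pi> *v x))"
    by (intro bounded_linear_const_scaleR matrix_vector_mul_bounded_linear)
  have step: "f (Suc t) = \<gamma> *\<^sub>R (P_pol P \<pi> *v f t)" for t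
    by (simp add: f_def matrix_vector_mult_scaleR)
  have V: "V \<pi> = suminf f"
    unfolding value_pol_def f_def ..
  have "suminf f = f 0 + (\<Sum>t. f (Suc t))"
    using suminf_split_head[OF sf] by simp
  also have "(\<Sum>t. f (Suc t)) = \<gamma> *\<^sub>R (P_pol P \<pi> *v suminf f)"
    unfolding step using bounded_linear.suminf[OF lin sf] by simp
  also have "f 0 = r_pol r \<pi>"
    by (simp add: f_def)
  finally show ?thesis
    by (simp only: V bellman_pol_def)
qed

text \<open>Subtracting the fixed-point equation of \<open>V \<pi>\<close> removes the reward, and
  the maximum principle applies to the difference.\<close>

lemma subsolution_le_value:
  assumes "x \<le> Tp \<pi> x"
  shows "x \<le> V \<pi>"
proof -
  have "x - V \<pi> \<le> \<gamma> *\<^sub>R (P_pol P \<pi> *v (x - V \<pi>))"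
    using assms Tp_add[of \<pi> "V \<pi>" "x - V \<pi>"] by (simp add: value_pol_fixpoint le_diff_eq diff_le_eq add.commute)
  then have "x - V \<pi> \<le> 0"
    using gamma_pos gamma_less_1 by (intro subinvariant_nonpos) auto
  then show ?thesis by simp
qed

lemma value_le_supersolution:
  assumes "Tp \<pi> x \<le> x"
  shows "V \<pi> \<le> x"
proof -
  have "V \<pi> = Tp \<pi> x + \<gamma> *\<^sub>R (P_pol P \<pi> *v (V \<pi> - x))"
    using Tp_add[of \<pi> x "V \<pi> - x"] by (simp add: value_pol_fixpoint)
  also have "\<dots> \<le> x + \<gamma> *\<^sub>R (P_pol P \<pi> *v (V \<pi> - x))"
    using assms by (rule add_right_mono)
  finally have "V \<pi> - x \<le> \<gamma> *\<^sub>R (P_pol P \<pi> *v (V \<pi> - x))"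
    by (simp add: diff_le_eq add.commute)
  then have "V \<pi> - x \<le> 0"
    using gamma_pos gamma_less_1 by (intro subinvariant_nonpos) auto
  then show ?thesis by simp
qed

lemma value_pol_bdd_above: "bdd_above (range (\<lambda>\<pi>. V \<pi> $ s))"
proof -
  obtain B where B: "\<And>\<pi> s. \<bar>r_pol r \<pi> $ s\<bar> \<le> B"
    using r_pol_bound by blast
  have "V \<pi> $ s \<le> B / (1 - \<gamma>)" for \<pi>
  proof -
    \<comment> \<open>The solution of \<open>c = B + \<gamma> * c\<close> is a constant
      supersolution for every policy at once.\<close>
    have "B + \<gamma> * (B / (1 - \<gamma>)) = B / (1 - \<gamma>)"
      using gamma_less_1 by (simp add: field_simps)
    then have "Tp \<pi> (vec (B / (1 - \<gamma>))) \<le> vec (B / (1 - \<gamma>))"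
      using B[of \<pi>] by (simp add: bellman_pol_def P_pol_vec less_eq_vec_def) (smt (verit))
    from value_le_supersolution[OF this] show ?thesis
      by (simp add: less_eq_vec_def)
  qed
  then show ?thesis
    by (intro bdd_aboveI) auto
qed

lemma value_pol_le_opt: "V \<pi> \<le> Vopt"
  by (auto simp: value_opt_def less_eq_vec_def intro!: cSUP_upper value_pol_bdd_above)

text \<open>Each \<open>V \<pi> = Tp \<pi> (V \<pi>)\<close> lies below
  \<open>Tp \<pi> Vopt\<close>, hence below \<open>T Vopt\<close>; then take the supremum over
  policies.\<close>

lemma value_opt_le_T: "Vopt \<le> T Vopt"
proof -
  have "V \<pi> \<le> T Vopt" for \<pi>
    using Tp_mono[OF value_pol_le_opt, of \<pi> \<pi>] Tp_le_T[of \<pi> Vopt]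
    by (simp add: value_pol_fixpoint)
  then show ?thesis
    by (auto simp: value_opt_def less_eq_vec_def intro!: cSUP_least)
qed

lemma value_opt_le_T_pow: "Vopt \<le> (T ^^ n) Vopt"
proof (induction n)
  case (Suc n)
  show ?case
    using order_trans[OF value_opt_le_T T_mono[OF Suc]] by simp
qed simp

text \<open>One-sided form of the contraction: a gap \<open>d\<close> below the optimal value
  shrinks to \<open>\<gamma> ^ n * d\<close>.\<close>

lemma value_opt_le_T_pow_shift:
  assumes "Vopt - vec d \<le> x"
  shows "Vopt - vec (\<gamma> ^ n * d) \<le> (T ^^ n) x"
proof -
  have "Vopt - vec (\<gamma> ^ n * d) \<le> (T ^^ n) Vopt - vec (\<gamma> ^ n * d)"
    by (intro diff_right_mono value_opt_le_T_pow)
  also have "\<dots> \<le> (T ^^ n) x"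
    using T_pow_mono[OF assms, of n] by (simp add: T_pow_shift)
  finally show ?thesis .
qed

section \<open>Evaluation operators, the common abstraction of both schemes\<close>

definition evaluation_op :: "('s, 'a) policy \<Rightarrow> real \<Rightarrow> (real ^ 's \<Rightarrow> real ^ 's) \<Rightarrow> bool" where
  "evaluation_op \<pi> \<beta> L \<longleftrightarrow>
     (\<forall>x c. L (x - vec c) = L x - vec (\<beta> * c)) \<and>
     (\<forall>x. x \<le> Tp \<pi> x \<longrightarrow> Tp \<pi> x \<le> L x \<and> L x \<le> Tp \<pi> (L x))"

text \<open>From a subsolution the iterates of \<open>Tp \<pi>\<close> increase and stay
  subsolutions; \<open>m \<ge> 1\<close> ensures that the first iterate is passed.\<close>

lemma evaluation_op_power:
  assumes "m \<ge> 1"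
  shows "evaluation_op \<pi> (\<gamma> ^ m) (Tp \<pi> ^^ m)"
  unfolding evaluation_op_def
proof (intro conjI allI impI)
  show "(Tp \<pi> ^^ m) (x - vec c) = (Tp \<pi> ^^ m) x - vec (\<gamma> ^ m * c)" for x c
    by (induction m) (simp_all add: Tp_shift mult.assoc)
  fix x assume x: "x \<le> Tp \<pi> x"
  have sub: "(Tp \<pi> ^^ n) x \<le> Tp \<pi> ((Tp \<pi> ^^ n) x)" for n
    by (induction n) (auto simp: x intro: Tp_mono)
  then show "(Tp \<pi> ^^ m) x \<le> Tp \<pi> ((Tp \<pi> ^^ m) x)" .
  show "Tp \<pi> x \<le> (Tp \<pi> ^^ m) x"
    using assms
  proof (induction m rule: dec_induct)
    case (step m)
    show ?case
      using order_trans[OF step.IH sub] by simp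
  qed simp
qed

text \<open>The operator adds \<open>z\<close>, the inverse matrix applied to the residual
  \<open>b = Tp \<pi> x - x\<close>. If \<open>b \<ge> 0\<close>, the maximum principle gives
  \<open>z \<ge> 0\<close>, so \<open>z \<ge> b\<close>, and the new residual is
  \<open>\<gamma> * (1 - l)\<close> times \<open>P_pol P \<pi> *v z\<close>, again
  nonnegative.\<close>

lemma evaluation_op_lambda:
  assumes l: "0 \<le> l" "l \<le> 1"
  shows "evaluation_op \<pi> (\<gamma> * (1 - l) / (1 - \<gamma> * l)) (bellman_lambda P r \<gamma> l \<pi>)"
  unfolding evaluation_op_def
proof (intro conjI allI impI)
  have "\<gamma> * l \<le> \<gamma>"
    using l gamma_pos by (intro mult_left_le) auto
  then have g: "0 \<le> \<gamma> * l" "\<gamma> * l < 1"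
    using l gamma_pos le_less_trans[OF _ gamma_less_1] by auto
  let ?N = "matrix_inv (mat 1 - (\<gamma> * l) *\<^sub>R P_pol P \<pi>)"
  fix x :: "real ^ 's"
  {
    fix c
    \<comment> \<open>Transition matrices fix constants, so on them the inverse is division by
      \<open>1 - \<gamma> * l\<close>. A shift by \<open>- c\<close> raises the residual by
      \<open>(1 - \<gamma>) * c\<close>, whose image is \<open>q\<close>.\<close>
    define q where "q = (1 - \<gamma>) * c / (1 - \<gamma> * l)"
    have "q = (1 - \<gamma>) * c + \<gamma> * l * q"
      using g by (simp add: q_def field_simps)
    then have "vec q = vec ((1 - \<gamma>) * c) + (\<gamma> * l) *\<^sub>R (P_pol P \<pi> *v vec q)"
      unfolding P_pol_vec by (simp add: vec_eq_iff)
    then have "?N *v vec ((1 - \<gamma>) * c) = vec q"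
      by (rule discount_inv_unique[OF g])
    moreover have shift: "Tp \<pi> (x - vec c) - (x - vec c) = (Tp \<pi> x - x) + vec ((1 - \<gamma>) * c)"
      by (simp add: Tp_shift vec_eq_iff algebra_simps)
    moreover have "- c + q = - (\<gamma> * (1 - l) / (1 - \<gamma> * l) * c)"
      using g by (simp add: q_def field_simps)
    ultimately show "bellman_lambda P r \<gamma> l \<pi> (x - vec c)
        = bellman_lambda P r \<gamma> l \<pi> x - vec (\<gamma> * (1 - l) / (1 - \<gamma> * l) * c)"
      unfolding bellman_lambda_def shift matrix_vector_right_distrib by (simp add: vec_eq_iff)
  }
  assume "x \<le> Tp \<pi> x"
  define b where "b = Tp \<pi> x - x"
  define z where "z = ?N *v b"
  have b: "0 \<le> b"
    using \<open>x \<le> Tp \<pi> x\<close> by (simp add: b_def)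
  define w where "w = (\<gamma> * l) *\<^sub>R (P_pol P \<pi> *v z)"
  have z: "z = b + w"
    unfolding w_def z_def by (rule discount_inv_eq[OF g])
  have "- z \<le> - w"
    using b z by simp
  then have "- z \<le> (\<gamma> * l) *\<^sub>R (P_pol P \<pi> *v (- z))"
    by (simp add: w_def matrix_vector_mult_uminus)
  then have "- z \<le> 0"
    by (rule subinvariant_nonpos[OF g])
  then have "0 \<le> P_pol P \<pi> *v z"
    using P_pol_mono[of 0 z P \<pi>] by (simp add: less_eq_vec_def)
  then have Pz: "0 \<le> (P_pol P \<pi> *v z) $ s" for s
    by (simp add: less_eq_vec_def)
  have L: "bellman_lambda P r \<gamma> l \<pi> x = x + z"
    by (simp add: bellman_lambda_def b_def z_def)
  have b_eq: "b = z - w"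
    by (simp add: z)
  have "b \<le> z"
    unfolding b_eq w_def using Pz g by (simp add: less_eq_vec_def)
  then show "Tp \<pi> x \<le> bellman_lambda P r \<gamma> l \<pi> x"
    unfolding L b_def by (simp add: algebra_simps)
  have "Tp \<pi> (x + z) - (x + z) = b + \<gamma> *\<^sub>R (P_pol P \<pi> *v z) - z"
    by (simp add: Tp_add b_def)
  also have "\<dots> = (\<gamma> * (1 - l)) *\<^sub>R (P_pol P \<pi> *v z)"
    unfolding b_eq w_def by (simp add: algebra_simps)
  also have "\<dots> \<ge> 0"
    using Pz gamma_pos l by (simp add: less_eq_vec_def)
  finally show "bellman_lambda P r \<gamma> l \<pi> x \<le> Tp \<pi> (bellman_lambda P r \<gamma> l \<pi> x)"
    unfolding L by simp
qed

section \<open>The error recursion, with \<open>n\<close> standing for \<open>h - 1\<close>\<close>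

lemma policy_iteration_bound:
  fixes L :: "('s, 'a) policy \<Rightarrow> real ^ 's \<Rightarrow> real ^ 's"
  assumes ev: "\<And>\<pi>. evaluation_op \<pi> \<beta> (L \<pi>)"
    and greedy: "\<And>k. \<pi> (Suc k) \<in> approx_greedy P r \<gamma> (Suc n) (del (Suc k)) (v k)"
    and step: "\<And>k. v (Suc k) = L (\<pi> (Suc k)) ((T ^^ n) (v k)) + err k"
    and err: "\<And>k. infnorm (err k) \<le> \<epsilon>"
    and del: "\<And>k. infnorm (del k) \<le> \<delta>"
    and D0: "(T ^^ n) (v 0) - vec (\<gamma> ^ n * (1 - \<gamma>) * D0) \<le> Tp (\<pi> 1) ((T ^^ n) (v 0))"
  shows "infnorm (Vopt - V (\<pi> (Suc k)))
      \<le> \<gamma> ^ (k * Suc n) * infnorm (Vopt - (v 0 - vec D0))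
         + (2 * \<gamma> ^ Suc n * \<epsilon> + \<delta>) * (1 - \<gamma> ^ (k * Suc n)) / ((1 - \<gamma>) * (1 - \<gamma> ^ Suc n))"
proof -
  \<comment> \<open>The three terms are the old shift as transported by \<open>T ^^ n\<close> and
    the evaluation, the price of the noise \<open>err\<close>, and the price of the greedy error,
    which becomes \<open>\<delta> / (1 - \<gamma>)\<close> after \<open>T ^^ n\<close>.\<close>
  define D where "D = rec_nat D0
    (\<lambda>_ d. \<beta> * \<gamma> ^ n * d + (1 + \<gamma>) * \<epsilon> / (1 - \<gamma>) + \<delta> / (\<gamma> ^ n * (1 - \<gamma>)))"
  have D_Suc: "D (Suc k)
      = \<beta> * \<gamma> ^ n * D k + (1 + \<gamma>) * \<epsilon> / (1 - \<gamma>) + \<delta> / (\<gamma> ^ n * (1 - \<gamma>))" for k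
    by (simp add: D_def)
  define x where "x k = (T ^^ n) (v k - vec (D k))" for k
  define y where "y k = Tp (\<pi> (Suc k)) (x k)" for k
  have x_eq: "x k = (T ^^ n) (v k) - vec (\<gamma> ^ n * D k)" for k
    by (simp add: x_def T_pow_shift)
  have errs: "\<bar>err k $ s\<bar> \<le> \<epsilon>" and dels: "\<bar>del k $ s\<bar> \<le> \<delta>" for k s
    using err del by (auto simp: infnorm_vec_le_iff)
  have pn: "\<gamma> ^ n > 0" "1 - \<gamma> > 0"
    using gamma_pos gamma_less_1 by auto
  \<comment> \<open>Shifting by \<open>c\<close> lowers both sides of the greedy inequality by
    \<open>\<gamma> ^ Suc n * c\<close>, so it survives every constant shift.\<close>
  have greedy': "(T ^^ Suc n) z - vec \<delta> \<le> Tp (\<pi> (Suc k)) ((T ^^ n) z)"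
    if z: "z = v k - vec c" for k z c
  proof -
    have "(T ^^ Suc n) (v k) - del (Suc k) \<le> Tp (\<pi> (Suc k)) ((T ^^ n) (v k))"
      using greedy[of k] by (simp add: approx_greedy_def)
    then have "(T ^^ Suc n) (v k) - vec \<delta> \<le> Tp (\<pi> (Suc k)) ((T ^^ n) (v k))"
      using dels[of "Suc k"] unfolding less_eq_vec_def
      by (simp del: funpow.simps) (smt (verit))
    then show ?thesis
      unfolding z T_pow_shift Tp_shift by (simp add: less_eq_vec_def mult.assoc del: funpow.simps)
  qed
  have v_Suc: "v (Suc k) - vec (\<beta> * \<gamma> ^ n * D k) = L (\<pi> (Suc k)) (x k) + err k" for k
  proof -
    have "L (\<pi> (Suc k)) (x k) = L (\<pi> (Suc k)) ((T ^^ n) (v k)) - vec (\<beta> * (\<gamma> ^ n * D k))"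
      using ev[of "\<pi> (Suc k)"] unfolding x_eq evaluation_op_def by blast
    then show ?thesis
      by (simp add: step vec_eq_iff mult.assoc)
  qed
  have sub: "x k \<le> y k" for k
  proof (induction k)
    \<comment> \<open>Subtracting \<open>vec c\<close> raises the residual by
      \<open>(1 - \<gamma>) * c\<close>; with \<open>c = \<gamma> ^ n * D0\<close> this is the
      assumption \<open>D0\<close>, and no greedy inequality enters.\<close>
    case 0
    show ?case
      using D0 unfolding y_def x_eq Tp_shift
      by (simp add: D_def less_eq_vec_def algebra_simps)
  next
    case (Suc k)
    let ?L = "L (\<pi> (Suc k)) (x k)"
    \<comment> \<open>The shift is made in two stages: \<open>a\<close> makes \<open>z\<close> a
      subsolution for the old policy, hence \<open>z \<le> T z\<close>; after \<open>T ^^ n\<close>,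
      the further shift \<open>e\<close> absorbs the loss \<open>\<delta>\<close> in changing to the
      new greedy policy.\<close>
    define e where "e = \<delta> / (1 - \<gamma>)"
    define q where "q = (1 + \<gamma>) * \<epsilon> / (1 - \<gamma>)"
    define a where "a = \<beta> * \<gamma> ^ n * D k + q"
    define z where "z = v (Suc k) - vec a"
    have z: "z = ?L + err k - vec q"
      unfolding z_def a_def v_Suc[symmetric] by (simp add: vec_eq_iff)
    have L: "?L \<le> Tp (\<pi> (Suc k)) ?L"
      using Suc ev[of "\<pi> (Suc k)"] unfolding y_def evaluation_op_def by blast
    have "z \<le> Tp (\<pi> (Suc k)) z"
    proof -
      have "?L - vec \<epsilon> \<le> ?L + err k"
        using errs[of k] by (simp add: less_eq_vec_def) (smt (verit))
      from Tp_mono[OF this, of "\<pi> (Suc k)"]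
      have "?L - vec (\<gamma> * \<epsilon>) \<le> Tp (\<pi> (Suc k)) (?L + err k)"
        using L unfolding Tp_shift by (simp add: less_eq_vec_def) (smt (verit))
      then have le: "?L $ s + err k $ s \<le> Tp (\<pi> (Suc k)) (?L + err k) $ s + (1 + \<gamma>) * \<epsilon>" for s
        using errs[of k s] by (auto simp: less_eq_vec_def algebra_simps dest!: spec[of _ s])
      \<comment> \<open>The noise worsens the residual by at most
        \<open>\<epsilon> + \<gamma> * \<epsilon>\<close>, and the shift by \<open>q\<close>
        recovers exactly this amount.\<close>
      have "q = (1 + \<gamma>) * \<epsilon> + \<gamma> * q"
        using pn by (simp add: q_def field_simps)
      then show ?thesis
        unfolding z Tp_shift less_eq_vec_def using le by simp (smt (verit))
    qed
    then have "z \<le> T z"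
      using Tp_le_T order_trans by blast
    then have "(T ^^ n) z \<le> (T ^^ Suc n) z"
      using T_pow_mono[of z "T z" n] by (simp add: funpow_swap1)
    then have "(T ^^ n) z - vec \<delta> \<le> Tp (\<pi> (Suc (Suc k))) ((T ^^ n) z)"
      using greedy'[OF z_def] by (simp add: less_eq_vec_def del: funpow.simps) (smt (verit))
    moreover have x_Suc: "x (Suc k) = (T ^^ n) z - vec e"
    proof -
      have "\<gamma> ^ n * D (Suc k) = \<gamma> ^ n * a + e"
        using pn gamma_pos by (simp add: D_Suc a_def e_def distrib_left flip: q_def)
      then show ?thesis
        by (simp add: x_eq z_def T_pow_shift vec_eq_iff)
    qed
    moreover have "e = \<delta> + \<gamma> * e"
      using pn by (simp add: e_def field_simps)
    ultimately show ?case
      unfolding y_def x_Suc Tp_shift by (simp add: less_eq_vec_def) (smt (verit))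
  qed
  \<comment> \<open>The new part of the shift \<open>D (Suc k)\<close> plus another
    \<open>\<epsilon>\<close>, because \<open>err k\<close> may lower \<open>v (Suc k)\<close>; this
    turns \<open>1 + \<gamma>\<close> into \<open>2\<close>.\<close>
  define c where "c = 2 * \<epsilon> / (1 - \<gamma>) + \<delta> / (\<gamma> ^ n * (1 - \<gamma>))"
  have y_Suc: "(T ^^ Suc n) (y k - vec c) - vec \<delta> \<le> y (Suc k)" for k
  proof -
    have "y k \<le> L (\<pi> (Suc k)) (x k)"
      using sub[of k] ev[of "\<pi> (Suc k)"] unfolding y_def evaluation_op_def by blast
    moreover have "L (\<pi> (Suc k)) (x k) - vec \<epsilon> \<le> v (Suc k) - vec (\<beta> * \<gamma> ^ n * D k)"
      using errs[of k] unfolding v_Suc by (simp add: less_eq_vec_def) (smt (verit))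
    moreover have "D (Suc k) = \<beta> * \<gamma> ^ n * D k + c - \<epsilon>"
      using pn by (simp add: D_Suc c_def field_simps)
    ultimately have "y k - vec c \<le> v (Suc k) - vec (D (Suc k))"
      by (simp add: less_eq_vec_def) (smt (verit))
    from T_pow_mono[OF this, of "Suc n"] greedy'[OF refl, of "Suc k" "D (Suc k)"]
    show ?thesis
      unfolding y_def x_def by (simp add: less_eq_vec_def del: funpow.simps) (smt (verit))
  qed
  define N where "N = infnorm (Vopt - (v 0 - vec D0))"
  \<comment> \<open>\<open>S k\<close> is the geometric sum of the first \<open>k\<close> powers of
    \<open>\<gamma> ^ Suc n\<close>, and \<open>K\<close> is the loss per iteration.\<close>
  define S where "S k = (1 - \<gamma> ^ (k * Suc n)) / (1 - \<gamma> ^ Suc n)" for k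
  define K where "K = (2 * \<gamma> ^ Suc n * \<epsilon> + \<delta>) / (1 - \<gamma>)"
  have pSuc: "\<gamma> ^ Suc n < 1"
    using gamma_pos gamma_less_1 by (intro power_Suc_less_one) auto
  have S_Suc: "S (Suc k) = \<gamma> ^ Suc n * S k + 1" for k
  proof -
    have "1 - \<gamma> ^ (Suc k * Suc n) = \<gamma> ^ Suc n * (1 - \<gamma> ^ (k * Suc n)) + (1 - \<gamma> ^ Suc n)"
      by (simp add: power_add algebra_simps)
    then show ?thesis
      using pSuc by (simp only: S_def add_divide_distrib) simp
  qed
  have K: "\<gamma> ^ Suc n * c + \<delta> = K"
  proof -
    have "\<gamma> ^ Suc n * c = (2 * \<gamma> ^ Suc n * \<epsilon> + \<gamma> * \<delta>) / (1 - \<gamma>)"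
      using gamma_pos by (simp add: c_def distrib_left add_divide_distrib)
    moreover have "\<delta> = (1 - \<gamma>) * \<delta> / (1 - \<gamma>)"
      using pn by simp
    ultimately have "\<gamma> ^ Suc n * c + \<delta>
        = (2 * \<gamma> ^ Suc n * \<epsilon> + \<gamma> * \<delta> + (1 - \<gamma>) * \<delta>) / (1 - \<gamma>)"
      by (simp only: add_divide_distrib)
    then show ?thesis
      by (simp add: K_def algebra_simps)
  qed
  have N0: "0 \<le> N"
    by (simp add: N_def infnorm_pos_le)
  have opt_y: "Vopt - vec (\<gamma> ^ (k * Suc n) * N + K * S k) \<le> y k" for k
  proof (induction k)
    case 0
    have "\<bar>(Vopt - (v 0 - vec D0)) $ s\<bar> \<le> N" for s
      unfolding N_def by (rule component_le_infnorm_cart)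
    then have "Vopt - vec N \<le> v 0 - vec D0"
      by (simp add: less_eq_vec_def abs_le_iff) (smt (verit))
    from value_opt_le_T_pow_shift[OF this, of n]
    have "Vopt - vec (\<gamma> ^ n * N) \<le> x 0"
      by (simp add: x_def D_def)
    \<comment> \<open>The gain \<open>\<gamma> ^ n\<close> is given up here, as the claim for
      \<open>k = 0\<close> has the factor 1.\<close>
    moreover have "\<gamma> ^ n * N \<le> N"
      using N0 gamma_pos gamma_less_1 by (simp add: mult_left_le_one_le power_le_one)
    ultimately show ?case
      using sub[of 0] by (simp add: S_def less_eq_vec_def) (smt (verit))
  next
    case (Suc k)
    let ?d = "\<gamma> ^ (k * Suc n) * N + K * S k"
    have "Vopt - vec (?d + c) \<le> y k - vec c"
      using Suc by (simp add: less_eq_vec_def algebra_simps)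
    from value_opt_le_T_pow_shift[OF this, of "Suc n"] y_Suc[of k]
    have "Vopt - vec (\<gamma> ^ Suc n * (?d + c)) - vec \<delta> \<le> y (Suc k)"
      by (simp add: less_eq_vec_def del: funpow.simps power_Suc) (smt (verit))
    moreover have "\<gamma> ^ Suc n * (?d + c) + \<delta> = \<gamma> ^ (Suc k * Suc n) * N + K * S (Suc k)"
      unfolding S_Suc K[symmetric] by (simp add: power_add algebra_simps)
    moreover have "Vopt - vec (\<gamma> ^ Suc n * (?d + c)) - vec \<delta> = Vopt - vec (\<gamma> ^ Suc n * (?d + c) + \<delta>)"
      by (simp add: vec_eq_iff del: power_Suc)
    ultimately show ?case
      by (simp only:)
  qed
  \<comment> \<open>Applying the monotone \<open>Tp\<close> to \<open>x k \<le> y k\<close> makes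
    \<open>y k\<close> a subsolution too, which places it below the value of its policy.\<close>
  have "y k \<le> Tp (\<pi> (Suc k)) (y k)"
    using Tp_mono[OF sub[of k]] unfolding y_def by blast
  then have "y k \<le> V (\<pi> (Suc k))"
    by (rule subsolution_le_value)
  with opt_y[of k] value_pol_le_opt[of "\<pi> (Suc k)"]
  have "infnorm (Vopt - V (\<pi> (Suc k))) \<le> \<gamma> ^ (k * Suc n) * N + K * S k"
    unfolding infnorm_vec_le_iff by (simp add: less_eq_vec_def) (smt (verit))
  then show ?thesis
    by (simp add: N_def K_def S_def)
qed

end

section \<open>Both schemes and the limit of the bound\<close>

theorem theorem4:
  fixes P :: "('s::finite, 'a::finite) kernel"
    and r :: "('s, 'a) reward"
    and R_min R_max \<gamma> l \<epsilon> \<delta> \<Delta>0 :: real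
    and h m :: nat
    and err del v :: "nat \<Rightarrow> real ^ 's"
    and \<pi> :: "nat \<Rightarrow> ('s, 'a) policy"
  assumes "\<forall>s a. r s a \<in> {R_min..R_max}"
    and "0 < \<gamma>" and "\<gamma> < 1"
    and "h \<ge> 1" and "m \<ge> 1"
    and "l \<in> {0..1}"
    and "\<forall>k. del k \<ge> 0"
    and "\<forall>k. infnorm (err k) \<le> \<epsilon>"
    and "\<forall>k. infnorm (del k) \<le> \<delta>"
    and "hm_PI P r \<gamma> h m err del v \<pi> \<or> hlambda_PI P r \<gamma> h l err del v \<pi>"
    and "\<Delta>0 = max 0 ((MAX s. ((bellman_opt P r \<gamma> ^^ (h - 1)) (v 0)
                 - bellman_pol P r \<gamma> (\<pi> 1) ((bellman_opt P r \<gamma> ^^ (h - 1)) (v 0))) $ s)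
               / (\<gamma> ^ (h - 1) * (1 - \<gamma>)))"
  shows "(\<forall>k. infnorm (value_opt P r \<gamma> - value_pol P r \<gamma> (\<pi> (Suc k)))
            \<le> \<gamma> ^ (k * h) * infnorm (value_opt P r \<gamma> - (v 0 - vec \<Delta>0))
               + (2 * \<gamma> ^ h * \<epsilon> + \<delta>) * (1 - \<gamma> ^ (k * h)) / ((1 - \<gamma>) * (1 - \<gamma> ^ h)))
       \<and> limsup (\<lambda>k. ereal (infnorm (value_opt P r \<gamma> - value_pol P r \<gamma> (\<pi> k))))
            \<le> ereal ((2 * \<gamma> ^ h * \<epsilon> + \<delta>) / ((1 - \<gamma>) * (1 - \<gamma> ^ h)))"
proof -
  interpret discounted_mdp P r \<gamma>
    using assms(2,3) by unfold_locales
  obtain n where h: "h = Suc n"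
    using \<open>h \<ge> 1\<close> by (cases h) auto
  \<comment> \<open>In either scheme \<open>\<beta>\<close> is the same for all policies, so a
    single scalar recursion serves the whole run.\<close>
  obtain \<beta> L where ev: "\<And>\<pi>. evaluation_op \<pi> \<beta> (L \<pi>)"
    and greedy: "\<And>k. \<pi> (Suc k) \<in> approx_greedy P r \<gamma> (Suc n) (del (Suc k)) (v k)"
    and step: "\<And>k. v (Suc k) = L (\<pi> (Suc k)) ((T ^^ n) (v k)) + err k"
  proof -
    consider "hm_PI P r \<gamma> h m err del v \<pi>" | "hlambda_PI P r \<gamma> h l err del v \<pi>"
      using assms(10) by blast
    then show ?thesis
    proof cases
      case 1
      then show ?thesis
        using that[OF evaluation_op_power[OF \<open>m \<ge> 1\<close>]] by (simp add: hm_PI_def h)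
    next
      case 2
      then show ?thesis
        using that[OF evaluation_op_lambda[of l]] \<open>l \<in> {0..1}\<close> by (simp add: hlambda_PI_def h)
    qed
  qed
  let ?g = "(T ^^ n) (v 0) - Tp (\<pi> 1) ((T ^^ n) (v 0))"
  have pn: "0 < \<gamma> ^ n * (1 - \<gamma>)"
    using gamma_pos gamma_less_1 by simp
  have "?g $ s \<le> \<gamma> ^ n * (1 - \<gamma>) * \<Delta>0" for s
  proof -
    have "?g $ s \<le> (MAX s. ?g $ s)"
      by (intro Max_ge) auto
    moreover have "(MAX s. ?g $ s) / (\<gamma> ^ n * (1 - \<gamma>)) \<le> \<Delta>0"
      using assms(11) by (simp add: h)
    ultimately show ?thesis
      using pn by (simp add: pos_divide_le_eq mult.commute)
  qed
  then have D0: "(T ^^ n) (v 0) - vec (\<gamma> ^ n * (1 - \<gamma>) * \<Delta>0) \<le> Tp (\<pi> 1) ((T ^^ n) (v 0))"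
    by (simp add: less_eq_vec_def algebra_simps)
  define N where "N = infnorm (Vopt - (v 0 - vec \<Delta>0))"
  define C where "C = (2 * \<gamma> ^ h * \<epsilon> + \<delta>) / ((1 - \<gamma>) * (1 - \<gamma> ^ h))"
  have bound: "infnorm (Vopt - V (\<pi> (Suc k)))
      \<le> \<gamma> ^ (k * h) * N + (2 * \<gamma> ^ h * \<epsilon> + \<delta>) * (1 - \<gamma> ^ (k * h)) / ((1 - \<gamma>) * (1 - \<gamma> ^ h))" for k
    unfolding N_def h using assms(8,9)
    by (intro policy_iteration_bound[OF ev greedy step _ _ D0]) auto
  have "(\<lambda>k. (\<gamma> ^ h) ^ k) \<longlonglongrightarrow> 0"
    using gamma_pos gamma_less_1 \<open>h \<ge> 1\<close>
    by (intro LIMSEQ_power_zero) (auto simp: power_less_one_iff)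
  then have "(\<lambda>k. \<gamma> ^ (k * h)) \<longlonglongrightarrow> 0"
    by (simp add: mult.commute flip: power_mult)
  then have "(\<lambda>k. \<gamma> ^ (k * h) * N + C * (1 - \<gamma> ^ (k * h))) \<longlonglongrightarrow> 0 * N + C * (1 - 0)"
    by (intro tendsto_intros)
  then have "limsup (\<lambda>k. ereal (\<gamma> ^ (k * h) * N + C * (1 - \<gamma> ^ (k * h)))) = ereal C"
    by (intro lim_imp_Limsup) auto
  moreover have "limsup (\<lambda>k. ereal (infnorm (Vopt - V (\<pi> (Suc k)))))
      \<le> limsup (\<lambda>k. ereal (\<gamma> ^ (k * h) * N + C * (1 - \<gamma> ^ (k * h))))"
    using bound by (intro Limsup_mono always_eventually) (simp add: C_def)
  \<comment> \<open>The bound concerns \<open>\<pi> (Suc k)\<close>; the index shift leaves the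
    limsup unchanged, so the unconstrained \<open>\<pi> 0\<close> does no harm.\<close>
  ultimately have "limsup (\<lambda>k. ereal (infnorm (Vopt - V (\<pi> k)))) \<le> ereal C"
    using limsup_shift[of "\<lambda>k. ereal (infnorm (Vopt - V (\<pi> k)))"] by simp
  then show ?thesis
    using bound unfolding N_def C_def by blast
qed

end
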